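(* Let $X$ be a separable infinite dimensional real Banach space, let $K<\infty$, and let $(x_i^n)_{n,i\in\omega}$ be a $K$-basic array in $X$. Then for every sequence of positive reals $\varepsilon_n\downarrow 0$ there exists a subsequence $(k_n)_{n\in\omega}$ of $\omega$ (i.e. $k_0<k_1<\cdots$) such that for all $n\in\omega$, all $(b_i)_{i\in n}\in[-1,1]^n$, and all integers $n\le i_0<\cdots<i_{n-1}$ and $n\le \ell_0<\cdots<\ell_{n-1}$, $$\left|\;\Big\|\sum_{j\in n} b_j\, x^j_{k_{i_j}}\Big\| - \Big\|\sum_{j\in n} b_j\, x^j_{k_{\ell_j}}\Big\|\;\right|<\varepsilon_n .$$
   Context: $\omega=\{0,1,2,\ldots\}$ and each $n\in\omega$ is identified with $\{0,\ldots,n-1\}$. A (finite or infinite) sequence of non-zero vectors $(z_i)$ in a Banach space is $K$-basic if $\|\sum_{i\in n}a_iz_i\|\le K\|\sum_{i\in m}a_iz_i\|$ for all $n<m$ (with $m$ at most the length of the sequence) and all real scalars $(a_i)$. A $K$-basic array in $X$ is a family $(x_i^n)_{n,i\in\omega}\subseteq X$ such that for every $n$ the row $(x_i^n)_{i\in\omega}$ is a normalized $K$-basic sequence, and for all $m\in\omega$ and all integers $m\le i_0<\cdots<i_{m-1}$ the sequence $(x_{i_j}^j)_{j\in m}$ is $K$-basic. *)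

theory Defs
  imports "HOL-Analysis.Analysis" "HOL-Library.Extended_Nat"
begin

(* N is the length of the sequence z, with N = \<infinity> for an infinite sequence;
   the entries z i with i \<ge> N are ignored. *)
definition basic_seq :: "real \<Rightarrow> enat \<Rightarrow> (nat \<Rightarrow> 'a::real_normed_vector) \<Rightarrow> bool" where
  "basic_seq K N z \<longleftrightarrow>
     (\<forall>i. enat i < N \<longrightarrow> z i \<noteq> 0) \<and>
     (\<forall>n m (a :: nat \<Rightarrow> real). n < m \<and> enat m \<le> N \<longrightarrow>
        norm (\<Sum>i<n. a i *\<^sub>R z i) \<le> K * norm (\<Sum>i<m. a i *\<^sub>R z i))"

(* An integer tuple c \<le> i_0 < ... < i_{n-1}, given by the values of i on {..<n}. *)
definition incr_tuple :: "nat \<Rightarrow> nat \<Rightarrow> (nat \<Rightarrow> nat) \<Rightarrow> bool" where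
  "incr_tuple c n i \<longleftrightarrow> strict_mono_on {..<n} i \<and> (\<forall>j<n. c \<le> i j)"

(* x n i is the i-th entry of row n. *)
definition basic_array :: "real \<Rightarrow> (nat \<Rightarrow> nat \<Rightarrow> 'a::real_normed_vector) \<Rightarrow> bool" where
  "basic_array K x \<longleftrightarrow>
     (\<forall>n. (\<forall>i. norm (x n i) = 1) \<and> basic_seq K \<infinity> (x n)) \<and>
     (\<forall>m i. incr_tuple m m i \<longrightarrow> basic_seq K (enat m) (\<lambda>j. x j (i j)))"

end

theory Submission
  imports Defs "HOL-Library.Ramsey" "HOL-Library.Diagonal_Subsequence"
begin

text \<open>
  For fixed \<open>n\<close> and \<open>b\<close> the norm in question is a bounded function of the \<open>n\<close>-element index set,
  so Ramsey's theorem makes it constant up to \<open>\<epsilon>\<close> on an infinite set. Since the norm is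
  \<open>1\<close>-Lipschitz in each coefficient, it suffices to do this for the finitely many \<open>b\<close> on a grid in
  the cube, simultaneously by colouring with the tuple of all rounded values. Diagonalising over
  \<open>n\<close> gives a single subsequence.
\<close>

lemma Ramsey_finite_colours:
  fixes f :: "'a set \<Rightarrow> 'b"
  assumes "infinite Z" "finite C" "f ` nsets Z r \<subseteq> C"
  obtains Y c where "Y \<subseteq> Z" "infinite Y" "f ` nsets Y r \<subseteq> {c}"
proof -
  \<comment> \<open>\<open>Ramsey_nsets\<close> takes its colours from an initial segment of the
    naturals, so the elements of \<open>C\<close> are numbered by \<open>h\<close>;
    \<open>inv_into C h t\<close> is then the common colour.\<close>
  obtain h where h: "bij_betw h C {..<card C}"
    using ex_bij_betw_finite_nat[OF \<open>finite C\<close>] by (auto simp: atLeast0LessThan)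
  have "(h \<circ> f) ` nsets Z r \<subseteq> {..<card C}"
    using h assms(3) by (fastforce simp: bij_betw_def)
  then obtain Y t where Y: "Y \<subseteq> Z" "infinite Y" "(h \<circ> f) ` nsets Y r \<subseteq> {t}"
    by (rule Ramsey_nsets[OF \<open>infinite Z\<close>])
  have "f A = inv_into C h t" if "A \<in> nsets Y r" for A
  proof -
    have "f A \<in> C"
      using that assms(3) nsets_mono[OF Y(1)] by blast
    moreover have "h (f A) = t"
      using that Y(3) by auto
    ultimately show ?thesis
      using h by (metis bij_betw_inv_into_left)
  qed
  then show thesis
    using that[OF Y(1,2), of "inv_into C h t"] by auto
qed

lemma abs_diff_less_if_floor_eq:
  fixes u v d :: real
  assumes "d > 0" "\<lfloor>u / d\<rfloor> = \<lfloor>v / d\<rfloor>"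
  shows "\<bar>u - v\<bar> < d"
proof -
  have "\<bar>u / d - v / d\<bar> < 1"
    using assms(2) by linarith
  then show ?thesis
    using assms(1) by (simp add: field_simps abs_if split: if_splits)
qed

lemma Ramsey_bounded_functions:
  fixes F :: "'b \<Rightarrow> 'a set \<Rightarrow> real"
  assumes "infinite Z" "finite G" "d > 0"
    and bound: "\<And>g A. g \<in> G \<Longrightarrow> A \<in> nsets Z r \<Longrightarrow> \<bar>F g A\<bar> \<le> M"
  obtains Y where "Y \<subseteq> Z" "infinite Y"
    "\<And>g A B. \<lbrakk>g \<in> G; A \<in> nsets Y r; B \<in> nsets Y r\<rbrakk> \<Longrightarrow> \<bar>F g A - F g B\<bar> < d"
proof -
  \<comment> \<open>The restriction to \<open>G\<close> makes the tuple extensional, so it lies in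
    the product \<open>C\<close>, which is finite because the bound \<open>M\<close> leaves finitely
    many values of each floor.\<close>
  define f where "f A = (\<lambda>g\<in>G. \<lfloor>F g A / d\<rfloor>)" for A
  define C where "C = (\<Pi>\<^sub>E g\<in>G. {\<lfloor>- M / d\<rfloor>..\<lfloor>M / d\<rfloor>})"
  have "finite C"
    unfolding C_def using \<open>finite G\<close> by (intro finite_PiE) auto
  moreover have "f ` nsets Z r \<subseteq> C"
  proof (clarsimp simp: f_def C_def)
    fix A g
    assume "A \<in> nsets Z r" "g \<in> G"
    then have "- M \<le> F g A" "F g A \<le> M"
      using bound[of g A] by auto
    then show "\<lfloor>- (M / d)\<rfloor> \<le> \<lfloor>F g A / d\<rfloor> \<and> \<lfloor>F g A / d\<rfloor> \<le> \<lfloor>M / d\<rfloor>"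
      using \<open>d > 0\<close> divide_right_mono[of "- M" "F g A" d]
      by (auto intro!: floor_mono divide_right_mono)
  qed
  ultimately obtain Y c where Y: "Y \<subseteq> Z" "infinite Y" "f ` nsets Y r \<subseteq> {c}"
    using Ramsey_finite_colours[OF \<open>infinite Z\<close>] by metis
  have "\<bar>F g A - F g B\<bar> < d" if "g \<in> G" "A \<in> nsets Y r" "B \<in> nsets Y r" for g A B
  proof -
    have "f A = f B"
      using Y(3) that(2,3) by blast
    then have "f A g = f B g"
      by simp
    then show ?thesis
      using \<open>g \<in> G\<close> by (intro abs_diff_less_if_floor_eq[OF \<open>d > 0\<close>]) (simp add: f_def)
  qed
  then show thesis
    using that Y by blast
qed

text \<open>Ramsey's theorem colours sets, while the norms depend on tuples. Sorting recovers an
  increasing tuple from its range, so nothing is lost in passing to sets.\<close>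

lemma sorted_list_of_set_image_strict_mono_on:
  fixes i :: "nat \<Rightarrow> 'a::linorder"
  assumes "strict_mono_on {..<n} i"
  shows "sorted_list_of_set (i ` {..<n}) = map i [0..<n]"
proof -
  have "sorted_wrt (<) (map i [0..<n])"
    using assms by (auto simp: sorted_wrt_iff_nth_less strict_mono_on_def)
  then have "sorted (map i [0..<n])" "distinct (map i [0..<n])"
    by (auto simp: strict_sorted_iff simp del: distinct_map)
  then show ?thesis
    by (metis atLeast_upt set_map sorted_list_of_set.idem_if_sorted_distinct)
qed

text \<open>Serves twice: with \<open>e = 1\<close> it bounds the coloured functions, and with
  \<open>e = 1 / N\<close> it controls the effect of rounding the coefficients.\<close>

lemma norm_sum_scaleR_le:
  fixes y :: "'b \<Rightarrow> 'a::real_normed_vector"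
    and c :: "'b \<Rightarrow> real" and e :: real
  assumes "\<And>j. j \<in> I \<Longrightarrow> norm (y j) \<le> 1" "\<And>j. j \<in> I \<Longrightarrow> \<bar>c j\<bar> \<le> e"
  shows "norm (\<Sum>j\<in>I. c j *\<^sub>R y j) \<le> card I * e"
proof -
  have "norm (c j *\<^sub>R y j) \<le> e" if "j \<in> I" for j
    using mult_mono[OF assms(2)[OF that] assms(1)[OF that]] assms(2)[OF that] by simp
  then show ?thesis
    by (rule sum_norm_bound)
qed

text \<open>The error splits into three parts below \<open>\<delta> / 3\<close>: rounding
  \<open>b\<close> along \<open>i\<close>, the oscillation left by Ramsey, and rounding
  \<open>b\<close> along \<open>l\<close>. The tuples may start anywhere; a lower bound on their
  entries enters only with the diagonal sequence.\<close>

lemma exists_subseq_norms_close: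
  fixes x :: "nat \<Rightarrow> nat \<Rightarrow> 'a::real_normed_vector" and \<delta> :: real
  assumes x: "\<And>j k. norm (x j k) \<le> 1" and "\<delta> > 0"
  obtains r :: "nat \<Rightarrow> nat" where "strict_mono r"
    "\<And>(b :: nat \<Rightarrow> real) i l.
       \<lbrakk>\<forall>j<n. b j \<in> {-1..1}; strict_mono_on {..<n} i; strict_mono_on {..<n} l\<rbrakk> \<Longrightarrow>
       \<bar>norm (\<Sum>j<n. b j *\<^sub>R x j (r (i j))) - norm (\<Sum>j<n. b j *\<^sub>R x j (r (l j)))\<bar> < \<delta>"
proof -
  obtain N :: nat where N: "N > 0" "n * (1 / N) < \<delta> / 3"
  proof -
    obtain N :: nat where "3 * n / \<delta> < N"
      using reals_Archimedean2 by blast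
    then show thesis
      using that[of N] \<open>\<delta> > 0\<close> by (cases "N = 0") (auto simp: field_simps)
  qed
  \<comment> \<open>A grid point of the cube with mesh \<open>1 / N\<close> is stored by its integer
    numerators: \<open>g\<close> stands for the coefficients \<open>g j / N\<close>.\<close>
  define G where "G = (\<Pi>\<^sub>E j\<in>{..<n}. {- int N..int N})"
  define F where "F g A = norm (\<Sum>j<n. (of_int (g j) / of_nat N) *\<^sub>R x j (sorted_list_of_set A ! j))"
    for g :: "nat \<Rightarrow> int" and A
  have "finite G"
    unfolding G_def by (intro finite_PiE) auto
  have bound: "\<bar>F g A\<bar> \<le> n" if "g \<in> G" for g A
  proof -
    have "\<bar>of_int (g j) / of_nat N\<bar> \<le> (1::real)" if "j \<in> {..<n}" for j
    proof -
      have "\<bar>g j\<bar> \<le> int N"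
        using \<open>g \<in> G\<close> that by (force simp: G_def PiE_iff)
      then have "\<bar>of_int (g j)\<bar> \<le> (of_nat N :: real)"
        by linarith
      then show ?thesis
        using \<open>N > 0\<close> by (simp add: field_simps)
    qed
    then have "F g A \<le> real (card {..<n}) * 1"
      unfolding F_def using x by (intro norm_sum_scaleR_le) auto
    then show ?thesis
      by (simp add: F_def)
  qed
  obtain Y :: "nat set" where Y: "infinite Y"
    "\<And>g A B. \<lbrakk>g \<in> G; A \<in> nsets Y n; B \<in> nsets Y n\<rbrakk> \<Longrightarrow> \<bar>F g A - F g B\<bar> < \<delta> / 3"
  proof (rule Ramsey_bounded_functions[of "UNIV :: nat set" G "\<delta> / 3" n F n])
    show "infinite (UNIV :: nat set)" "finite G" "\<delta> / 3 > 0"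
      using \<open>finite G\<close> \<open>\<delta> > 0\<close> by auto
  qed (use bound in blast)+
  define r where "r = enumerate Y"
  have "strict_mono r"
    using Y(1) by (simp add: r_def strict_mono_def)
  have "\<bar>norm (\<Sum>j<n. b j *\<^sub>R x j (r (i j))) - norm (\<Sum>j<n. b j *\<^sub>R x j (r (l j)))\<bar> < \<delta>"
    if b: "\<forall>j<n. b j \<in> {-1..1}"
      and il: "strict_mono_on {..<n} i" "strict_mono_on {..<n} l" for b :: "nat \<Rightarrow> real" and i l
  proof -
    \<comment> \<open>Rounding down to the grid stays inside the cube, because its endpoints -1 and
      1 are grid values.\<close>
    define g where "g = (\<lambda>j\<in>{..<n}. \<lfloor>b j * N\<rfloor>)"
    have "g \<in> G"
    proof -
      have "- int N \<le> \<lfloor>b j * N\<rfloor> \<and> \<lfloor>b j * N\<rfloor> \<le> int N" if "j < n" for j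
      proof -
        have "- 1 \<le> b j" "b j \<le> 1"
          using b that by auto
        then have "- real N \<le> b j * N" "b j * N \<le> real N"
          using mult_right_mono[of "- 1" "b j" "real N"] mult_right_mono[of "b j" 1 "real N"] by auto
        then show ?thesis
          by linarith
      qed
      then show ?thesis
        by (auto simp: g_def G_def)
    qed
    have approx: "(r \<circ> t) ` {..<n} \<in> nsets Y n \<and>
        \<bar>norm (\<Sum>j<n. b j *\<^sub>R x j (r (t j))) - F g ((r \<circ> t) ` {..<n})\<bar> \<le> n * (1 / N)"
      if t: "strict_mono_on {..<n} t" for t
    proof -
      have rt: "strict_mono_on {..<n} (r \<circ> t)"
        using t \<open>strict_mono r\<close> by (auto simp: strict_mono_on_def strict_mono_def)
      then have "card ((r \<circ> t) ` {..<n}) = n"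
        using card_image[OF strict_mono_on_imp_inj_on[OF rt]] by simp
      moreover have "(r \<circ> t) ` {..<n} \<subseteq> Y"
        using Y(1) by (auto simp: r_def enumerate_in_set)
      ultimately have "(r \<circ> t) ` {..<n} \<in> nsets Y n"
        by (simp add: nsets_def)
      moreover have "F g ((r \<circ> t) ` {..<n}) =
          norm (\<Sum>j<n. (of_int (g j) / of_nat N) *\<^sub>R x j (r (t j)))"
        unfolding F_def sorted_list_of_set_image_strict_mono_on[OF rt]
        by (intro arg_cong[where f = norm] sum.cong) auto
      moreover have "\<bar>norm (\<Sum>j<n. b j *\<^sub>R x j (r (t j))) -
          norm (\<Sum>j<n. (of_int (g j) / of_nat N) *\<^sub>R x j (r (t j)))\<bar> \<le> n * (1 / N)"
      proof -
        have "\<bar>b j - of_int (g j) / of_nat N\<bar> \<le> 1 / N" if "j \<in> {..<n}" for j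
        proof -
          have "\<bar>b j * N - of_int (g j)\<bar> \<le> 1"
            using that by (simp add: g_def) linarith
          then have "\<bar>(b j * N - of_int (g j)) / N\<bar> \<le> 1 / N"
            using \<open>N > 0\<close> by (simp add: field_simps)
          then show ?thesis
            using \<open>N > 0\<close> by (simp add: diff_divide_distrib)
        qed
        then have "norm (\<Sum>j<n. (b j - of_int (g j) / of_nat N) *\<^sub>R x j (r (t j)))
            \<le> card {..<n} * (1 / N)"
          using x by (intro norm_sum_scaleR_le) auto
        then show ?thesis
          \<comment> \<open>The reverse triangle inequality reduces the claim to the norm of the
            difference of the two sums.\<close>
          by (intro order_trans[OF norm_triangle_ineq3])
             (simp add: scaleR_diff_left sum_subtractf)
      qed
      ultimately show ?thesis
        by simp
    qed
    show ?thesis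
      using approx[OF il(1)] approx[OF il(2)] N(2)
        Y(2)[OF \<open>g \<in> G\<close> conjunct1[OF approx[OF il(1)]] conjunct1[OF approx[OF il(2)]]]
      by linarith
  qed
  then show thesis
    using that \<open>strict_mono r\<close> by blast
qed

theorem proposition3p1:
  fixes x :: "nat \<Rightarrow> nat \<Rightarrow> 'a::banach"
    and K :: real
    and \<epsilon> :: "nat \<Rightarrow> real"
  assumes "separable_space (euclidean :: 'a topology)"
    and "\<not> (\<exists>B :: 'a set. finite B \<and> span B = UNIV)"
    and "basic_array K x"
    and "\<And>n. \<epsilon> n > 0"
    and "decseq \<epsilon>"
    and "\<epsilon> \<longlonglongrightarrow> 0"
  shows "\<exists>k :: nat \<Rightarrow> nat. strict_mono k \<and>
    (\<forall>n (b :: nat \<Rightarrow> real) i l.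
       (\<forall>j<n. b j \<in> {-1..1}) \<longrightarrow> incr_tuple n n i \<longrightarrow> incr_tuple n n l \<longrightarrow>
       \<bar>norm (\<Sum>j<n. b j *\<^sub>R x j (k (i j))) - norm (\<Sum>j<n. b j *\<^sub>R x j (k (l j)))\<bar> < \<epsilon> n)"
proof -
  have x: "norm (x j k) \<le> 1" for j k
    using assms(3) by (simp add: basic_array_def)
  \<comment> \<open>Stage \<open>n\<close> handles tuples of length \<open>Suc n\<close>, since
    \<open>diagseq_holds\<close> gives \<open>P n\<close> for the diagonal sequence from index
    \<open>Suc n\<close> on. This matches the requirement that a tuple start no earlier than its
    length.\<close>
  define P where "P n s \<longleftrightarrow> (\<forall>(b :: nat \<Rightarrow> real) i l. (\<forall>j<Suc n. b j \<in> {-1..1}) \<longrightarrow>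
      strict_mono_on {..<Suc n} i \<longrightarrow> strict_mono_on {..<Suc n} l \<longrightarrow>
      \<bar>norm (\<Sum>j<Suc n. b j *\<^sub>R x j (s (i j))) - norm (\<Sum>j<Suc n. b j *\<^sub>R x j (s (l j)))\<bar> < \<epsilon> (Suc n))"
    for n and s :: "nat \<Rightarrow> nat"
  interpret subseqs P
  proof
    fix n and s :: "nat \<Rightarrow> nat"
    show "\<exists>r. strict_mono r \<and> P n (s \<circ> r)"
    \<comment> \<open>The array is first thinned along \<open>s\<close>, so the new \<open>r\<close>
      refines the subsequence already chosen.\<close>
    proof (rule exists_subseq_norms_close[of "\<lambda>j k. x j (s k)" "\<epsilon> (Suc n)" "Suc n"])
      fix r :: "nat \<Rightarrow> nat"
      assume "strict_mono r" and
        "\<And>(b :: nat \<Rightarrow> real) i l. \<lbrakk>\<forall>j<Suc n. b j \<in> {-1..1}; strict_mono_on {..<Suc n} i;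
           strict_mono_on {..<Suc n} l\<rbrakk> \<Longrightarrow>
           \<bar>norm (\<Sum>j<Suc n. b j *\<^sub>R x j (s (r (i j)))) -
             norm (\<Sum>j<Suc n. b j *\<^sub>R x j (s (r (l j))))\<bar> < \<epsilon> (Suc n)"
      then show ?thesis
        by (intro exI[of _ r] conjI) (simp_all add: P_def del: sum.lessThan_Suc)
    qed (use x assms(4) in auto)
  qed
  have tail: "P n (diagseq \<circ> (+) (Suc n))" for n
  proof (rule diagseq_holds)
    fix r s :: "nat \<Rightarrow> nat" and n
    assume r: "strict_mono r" and P: "P n s"
    \<comment> \<open>\<open>P n\<close> survives further thinning: tuples along
      \<open>s \<circ> r\<close> are tuples along \<open>s\<close> with indices
      \<open>r \<circ> i\<close>.\<close>
    have "strict_mono_on {..<Suc n} (r \<circ> i)" if "strict_mono_on {..<Suc n} i" for i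
      using r that by (auto simp: strict_mono_on_def strict_mono_def)
    with P show "P n (s \<circ> r)"
      by (simp add: P_def o_def del: sum.lessThan_Suc)
  qed
  show ?thesis
  proof (intro exI conjI allI impI)
    show "strict_mono diagseq"
      by (rule subseq_diagseq)
    fix n :: nat and b :: "nat \<Rightarrow> real" and i l
    assume b: "\<forall>j<n. b j \<in> {-1..1}" and il: "incr_tuple n n i" "incr_tuple n n l"
    show "\<bar>norm (\<Sum>j<n. b j *\<^sub>R x j (diagseq (i j))) - norm (\<Sum>j<n. b j *\<^sub>R x j (diagseq (l j)))\<bar> < \<epsilon> n"
    proof (cases n)
      case 0
      then show ?thesis
        using assms(4)[of 0] by simp
    next
      case (Suc m)
      \<comment> \<open>Entries of \<open>t\<close> are at least \<open>n\<close>, so the truncated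
        subtraction is exact and re-indexes the tuple for the tail of \<open>diagseq\<close>
        starting at \<open>n\<close>.\<close>
      have shift: "strict_mono_on {..<n} (\<lambda>j. t j - n)"
        "(\<Sum>j<n. b j *\<^sub>R x j (diagseq (n + (t j - n)))) = (\<Sum>j<n. b j *\<^sub>R x j (diagseq (t j)))"
        if "incr_tuple n n t" for t
        using that by (auto simp: incr_tuple_def strict_mono_on_def diff_less_mono)
      show ?thesis
        using P_def[THEN iffD1, OF tail[of m], folded Suc, THEN spec, THEN spec, THEN spec,
            THEN mp, OF b, THEN mp, OF shift(1)[OF il(1)], THEN mp, OF shift(1)[OF il(2)]]
          shift(2)[OF il(1)] shift(2)[OF il(2)]
        by (simp del: sum.lessThan_Suc)
    qed
  qed
qed

end
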